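(* Let $1<p<\infty$, $\frac1p+\frac1{p'}=1$, and let $\Omega=(\Omega_n)_{n\ge0}$ be a sequence of nonnegative numbers with $\Omega_0\ne0$ and $\Omega\notin\ell^1$. Then $d(\Omega,p)'=d(\Omega^{1-p'},p')$ if and only if there is a constant $C<\infty$ such that $$\sum_{k=0}^n\Omega_k^{1-p'}\le C\sum_{k=0}^n\big(A_d\Omega(k)\big)^{1-p'},\qquad n=0,1,2,\dots$$ In particular $d(\Omega,p)'=d(\Omega^{1-p'},p')$ if $\Omega$ is regular.
   Context: Let $\mathbb N^*=\{0,1,2,\dots\}$ with counting measure. For a sequence $f=(f(n))_{n\ge0}\subset\mathbb C$, $f^*$ denotes its nonincreasing rearrangement, $f^*(n)=\inf\{s>0:\#\{k:|f(k)|>s\}\le n\}$. For a sequence $\Omega=(\Omega_n)_{n\ge 0}$ and $0<p<\infty$, $\|f\|_{d(\Omega,p)}=\big(\sum_{n=0}^\infty f^*(n)^p\,\Omega_n\big)^{1/p}$ and $d(\Omega,p)=\{f:\|f\|_{d(\Omega,p)}<\infty\}$. $\Omega^{1-p'}$ is the sequence $(\Omega_n^{1-p'})_n$ (with $0^{1-p'}=+\infty$ and $0\cdot\infty=0$). The associate space is $d(\Omega,p)'=\{f:\|f\|_{d(\Omega,p)'}<\infty\}$, where $\|f\|_{d(\Omega,p)'}=\sup\{\sum_n|f(n)g(n)|:\|g\|_{d(\Omega,p)}\le1\}$. Equality of two spaces means that they have the same elements, with equivalent norms (functionals). $A_d$ is the discrete Hardy operator, $A_df(n)=\frac1{n+1}\sum_{k=0}^nf(k)$.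 The sequence $\Omega$ is regular if there is $C>0$ with $\frac1{n+1}\sum_{k=0}^n\Omega_k\le C\,\Omega_n$ for all $n\ge0$. *)

theory Defs
  imports "HOL-Analysis.Analysis"
begin

text \<open>Powers with real exponent on \<open>[0,\<infinity>]\<close>, with \<open>0 powr a = \<infinity>\<close> and \<open>\<infinity> powr a = 0\<close>
  for \<open>a < 0\<close>. The convention \<open>0 * \<infinity> = 0\<close> is that of \<^typ>\<open>ennreal\<close>.\<close>

definition ennreal_powr :: "ennreal \<Rightarrow> real \<Rightarrow> ennreal" where
  "ennreal_powr x a =
     (if a = 0 then 1
      else if x = 0 then (if a < 0 then \<infinity> else 0)
      else if x = \<infinity> then (if a < 0 then 0 else \<infinity>)
      else ennreal (enn2real x powr a))"

text \<open>The infimum is taken in \<^typ>\<open>ennreal\<close>, so that it is \<open>\<infinity>\<close> over the empty set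
  (which occurs exactly for unbounded \<open>f\<close>); \<^const>\<open>emeasure\<close> is used because
  \<^const>\<open>card\<close> vanishes on infinite sets.\<close>

definition rearrangement :: "(nat \<Rightarrow> complex) \<Rightarrow> nat \<Rightarrow> ennreal" where
  "rearrangement f n =
     Inf {ennreal s | s :: real. 0 < s \<and>
            emeasure (count_space UNIV) {k. norm (f k) > s} \<le> of_nat n}"

definition lorentz_norm :: "(nat \<Rightarrow> ennreal) \<Rightarrow> real \<Rightarrow> (nat \<Rightarrow> complex) \<Rightarrow> ennreal" where
  "lorentz_norm \<Omega> p f =
     ennreal_powr (\<Sum>n. ennreal_powr (rearrangement f n) p * \<Omega> n) (1 / p)"

text \<open>A sequence space is represented by the \<open>[0,\<infinity>]\<close>-valued functional that defines it.\<close>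

definition space_of :: "((nat \<Rightarrow> complex) \<Rightarrow> ennreal) \<Rightarrow> (nat \<Rightarrow> complex) set" where
  "space_of N = {f. N f < \<infinity>}"

definition associate_norm ::
    "((nat \<Rightarrow> complex) \<Rightarrow> ennreal) \<Rightarrow> (nat \<Rightarrow> complex) \<Rightarrow> ennreal" where
  "associate_norm N f = (SUP g \<in> {g. N g \<le> 1}. \<Sum>n. ennreal (norm (f n * g n)))"

definition same_space ::
    "((nat \<Rightarrow> complex) \<Rightarrow> ennreal) \<Rightarrow> ((nat \<Rightarrow> complex) \<Rightarrow> ennreal) \<Rightarrow> bool" where
  "same_space N M \<longleftrightarrow>
     space_of N = space_of M \<and>
     (\<exists>c C :: real. 0 < c \<and> 0 < C \<and>
        (\<forall>f \<in> space_of N. ennreal c * N f \<le> M f \<and> M f \<le> ennreal C * N f))"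

definition discrete_hardy :: "(nat \<Rightarrow> 'a::field_char_0) \<Rightarrow> nat \<Rightarrow> 'a" where
  "discrete_hardy f n = (\<Sum>k\<le>n. f k) / of_nat (n + 1)"

definition regular_seq :: "(nat \<Rightarrow> real) \<Rightarrow> bool" where
  "regular_seq \<Omega> \<longleftrightarrow> (\<exists>C>0. \<forall>n. discrete_hardy \<Omega> n \<le> C * \<Omega> n)"

end

(* Hoelder's inequality with the weight Omega, combined with the Hardy-Littlewood rearrangement
inequality, always gives ||f||' <= ||f||_{d(Omega^{1-p'},p')}, so only the reverse estimate depends on
Omega. Write W for the partial sums of Omega, c(k) = W(k)/(k+1) and T = c^{1-p'}.

Necessity. For decreasing h, Hoelder's inequality with u(k) = min_{k<=j<=n} c(j) in place of Omega bounds
h(0)+...+h(n): Abel summation applies because u(0)+...+u(m) <= (m+1) c(m) = W(m). As W increases,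
T(i) >= ((i+1)/(j+1))^{p'-1} T(j) for i <= j, and cutting {0..n} at successive minima of c gives
sum u^{1-p'} <= p' sum T. Hence the associate norm of the characteristic function of {0..n} is at most
(p' (T(0)+...+T(n)))^{1/p'}, and the condition is the comparison of the two norms there.

Sufficiency. Let f* be truncated at n, F its partial sums, y(k) = max_{k<=j<=n} F(j)/W(j) and
h = y^{p'-1}. Whenever y drops after k one has F(k) = W(k) y(k), so Abel summation and Young's
inequality give sum h^p Omega <= p sum f* h. Testing the associate norm with h yields
sum f*^{p'} T <= sum f* h <= C (||f||')^{p'}, and the condition allows Omega^{1-p'} in place of T
by another Abel summation. To avoid discussing whether f* is attained, f*/2 is used for f*: its values
are exceeded by |f| at enough indices to choose distinct positions one by one. *)
theory Submission
  imports Defs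
begin

subsection \<open>Powers and inequalities in the extended nonnegative reals\<close>


lemma ennreal_powr_ennreal:
  assumes "0 < r \<or> (r = 0 \<and> 0 < a)"
  shows "ennreal_powr (ennreal r) a = ennreal (r powr a)"
  using assms by (auto simp: ennreal_powr_def)

lemma ennreal_powr_one [simp]: "ennreal_powr x 1 = x"
  by (cases x) (auto simp: ennreal_powr_def)

lemma ennreal_powr_one_base [simp]: "ennreal_powr 1 a = 1"
  by (simp add: ennreal_powr_def)

lemma ennreal_powr_top: "0 < a \<Longrightarrow> ennreal_powr top a = top"
  by (simp add: ennreal_powr_def)

lemma ennreal_powr_mono:
  assumes "x \<le> y" "0 < a"
  shows "ennreal_powr x a \<le> ennreal_powr y a"
proof (cases y)
  case (real s)
  with assms(1) obtain r where r: "x = ennreal r" "0 \<le> r" "r \<le> s"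
    by (metis ennreal_cases ennreal_le_iff ennreal_less_top leD order_le_less top.not_eq_extremum)
  then have "ennreal_powr x a = ennreal (r powr a)" "ennreal_powr y a = ennreal (s powr a)"
    using assms(2) real ennreal_powr_ennreal by (metis order_le_less)+
  then show ?thesis using r assms(2) by (simp add: ennreal_leI powr_mono2)
next
  case top
  then show ?thesis using assms(2) by (simp add: ennreal_powr_top)
qed

lemma ennreal_powr_powr:
  assumes "0 < a" "0 < b"
  shows "ennreal_powr (ennreal_powr x a) b = ennreal_powr x (a * b)"
proof (cases x)
  case (real r)
  then have "0 < r \<or> r = 0" by auto
  then show ?thesis
    using assms real by (auto simp: ennreal_powr_ennreal powr_powr)
next
  case top
  then show ?thesis using assms by (simp add: ennreal_powr_top)
qed

lemma ennreal_powr_eq_0_iff: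
  assumes "0 < a"
  shows "ennreal_powr x a = 0 \<longleftrightarrow> x = 0"
  using assms by (cases x) (auto simp: ennreal_powr_def)

text \<open>A positive exponent fixes 0 and infinity, so the convention for their product is
  respected on both sides. For a negative exponent the pair 0, infinity would break the
  identity.\<close>

lemma ennreal_powr_mult:
  assumes "0 < a"
  shows "ennreal_powr (x * y) a = ennreal_powr x a * ennreal_powr y a"
proof -
  consider "x = 0 \<or> y = 0" | "x \<noteq> 0" "y \<noteq> 0" "x = top \<or> y = top"
    | "x \<noteq> 0" "y \<noteq> 0" "x \<noteq> top" "y \<noteq> top" by metis
  then show ?thesis
  proof cases
    case 1
    have "ennreal_powr 0 a = 0" using ennreal_powr_eq_0_iff[OF assms, of 0] by simp
    then show ?thesis using 1 by (metis mult_zero_left mult_zero_right)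
  next
    case 2
    then have "x * y = top" by (auto simp: ennreal_mult_eq_top_iff)
    moreover have "ennreal_powr x a * ennreal_powr y a = top"
      using 2 ennreal_powr_eq_0_iff[OF assms] ennreal_powr_top[OF assms]
      by (metis ennreal_mult_eq_top_iff)
    ultimately show ?thesis using ennreal_powr_top[OF assms] by simp
  next
    case 3
    then obtain r s where rs: "x = ennreal r" "0 < r" "y = ennreal s" "0 < s"
      by (metis ennreal_cases ennreal_0 order_le_less)
    then have "x * y = ennreal (r * s)" by (simp add: ennreal_mult)
    then have "ennreal_powr (x * y) a = ennreal ((r * s) powr a)"
      using rs by (simp add: ennreal_powr_ennreal del: ennreal_mult)
    then show ?thesis
      using rs by (simp add: ennreal_powr_ennreal powr_mult ennreal_mult)
  qed
qed

lemma ennreal_powr_neg_pos: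
  assumes "x < \<infinity>" "a < 0"
  shows "0 < ennreal_powr x a"
  using assms by (cases x) (auto simp: ennreal_powr_def)

lemma ennreal_powr_less_top:
  assumes "0 < a"
  shows "ennreal_powr x a < \<infinity> \<longleftrightarrow> x < \<infinity>"
  using assms by (cases x) (auto simp: ennreal_powr_def)

lemma sum_le_suminf_ennreal:
  fixes f :: "nat \<Rightarrow> ennreal"
  assumes "finite A"
  shows "sum f A \<le> suminf f"
  using assms by (intro sum_le_suminf) auto

lemma suminf_le_ennreal:
  fixes f :: "nat \<Rightarrow> ennreal"
  assumes "\<And>n. (\<Sum>k\<le>n. f k) \<le> c"
  shows "suminf f \<le> c"
proof -
  have "(\<Sum>k<n. f k) \<le> c" for n
    using assms[of n] by (rule order_trans[rotated]) (intro sum_mono2, auto)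
  then show ?thesis by (intro suminf_le_const) auto
qed

lemma conjugate_exponent_gt_one:
  fixes p q :: real
  assumes "1 < p" "1 / p + 1 / q = 1"
  shows "1 < q"
proof -
  have "1 / p < 1" using assms(1) by simp
  with assms(2) have "0 < 1 / q" by linarith
  then have q0: "0 < q" by simp
  have "1 / q < 1" using assms by (smt (verit) zero_less_divide_iff)
  then show ?thesis using q0 by (simp add: field_simps)
qed

section \<open>Hoelder's inequality and Abel summation\<close>

lemma Holder_sum_real:
  fixes x y :: "'a \<Rightarrow> real"
  assumes fin: "finite A" and p: "1 < p" and pq: "1 / p + 1 / q = 1"
    and nn: "\<And>k. k \<in> A \<Longrightarrow> 0 \<le> x k" "\<And>k. k \<in> A \<Longrightarrow> 0 \<le> y k"
  shows "(\<Sum>k\<in>A. x k * y k) \<le> (\<Sum>k\<in>A. x k powr p) powr (1 / p) * (\<Sum>k\<in>A. y k powr q) powr (1 / q)"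
proof -
  have q: "1 < q" using p pq by (rule conjugate_exponent_gt_one)
  define X Y where "X = (\<Sum>k\<in>A. x k powr p)" and "Y = (\<Sum>k\<in>A. y k powr q)"
  have XY: "0 \<le> X" "0 \<le> Y" unfolding X_def Y_def by (auto intro: sum_nonneg)
  show ?thesis
  proof (cases "X = 0 \<or> Y = 0")
    case True
    then have "x k * y k = 0" if "k \<in> A" for k
      using fin that by (auto simp: X_def Y_def sum_nonneg_eq_0_iff)
    then have "(\<Sum>k\<in>A. x k * y k) = 0" by (intro sum.neutral) blast
    then show ?thesis by simp
  next
    case False
    with XY have pos: "0 < X" "0 < Y" by auto
    \<comment> \<open>Dividing by the two norms \<open>a\<close> and \<open>b\<close> reduces the
      claim to Young's inequality term by term; the bounds then add up to 1/p + 1/q = 1.\<close>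
    define a b where "a = X powr (1 / p)" and "b = Y powr (1 / q)"
    have ab: "0 < a" "0 < b" using pos by (auto simp: a_def b_def)
    have apow: "a powr p = X" "b powr q = Y"
      using pos p q by (auto simp: a_def b_def powr_powr)
    have "(\<Sum>k\<in>A. (x k / a) * (y k / b)) \<le> (\<Sum>k\<in>A. (x k / a) powr p / p + (y k / b) powr q / q)"
      using p q pq ab nn by (intro sum_mono Youngs_inequality) auto
    also have "\<dots> = (\<Sum>k\<in>A. x k powr p / X / p + y k powr q / Y / q)"
      using ab nn by (intro sum.cong) (auto simp: powr_divide apow)
    also have "\<dots> = X / X / p + Y / Y / q"
      unfolding sum.distrib sum_divide_distrib[symmetric] X_def Y_def ..
    also have "\<dots> = 1" using pos pq by simp
    finally have "(\<Sum>k\<in>A. x k * y k) / (a * b) \<le> 1"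
      by (simp add: sum_divide_distrib)
    then show ?thesis using ab by (simp add: a_def b_def X_def Y_def field_simps)
  qed
qed

text \<open>Weights may vanish and values may be infinite. If the right-hand side is finite, every
  \<open>k\<close> with nonzero \<open>f k\<close> has positive weight and finite \<open>f k\<close>
  and \<open>g k\<close>, so real Hoelder applies to f w^(-1/p) and g w^(1/p).\<close>

lemma weighted_Holder:
  fixes f g :: "'a \<Rightarrow> ennreal" and w :: "'a \<Rightarrow> real"
  assumes fin: "finite A" and p: "1 < p" and pq: "1 / p + 1 / q = 1"
    and w: "\<And>k. k \<in> A \<Longrightarrow> 0 \<le> w k"
    and g: "(\<Sum>k\<in>A. ennreal_powr (g k) p * ennreal (w k)) \<le> 1"
  shows "(\<Sum>k\<in>A. f k * g k)
    \<le> ennreal_powr (\<Sum>k\<in>A. ennreal_powr (f k) q * ennreal_powr (ennreal (w k)) (1 - q)) (1 / q)"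
proof (cases "(\<Sum>k\<in>A. ennreal_powr (f k) q * ennreal_powr (ennreal (w k)) (1 - q)) = \<infinity>")
  case True
  have "1 < q" using p pq by (rule conjugate_exponent_gt_one)
  with True show ?thesis by (simp add: ennreal_powr_def)
next
  case False
  have q: "1 < q" using p pq by (rule conjugate_exponent_gt_one)
  then have q0: "0 < 1 / q" and q0': "0 < q" by auto
  have qp: "1 - q = - (q / p)" using pq q p by (simp add: field_simps)
  have fin_f: "ennreal_powr (f k) q * ennreal_powr (ennreal (w k)) (1 - q) \<noteq> \<infinity>" if "k \<in> A" for k
    using False fin that by auto
  have fin_g: "ennreal_powr (g k) p * ennreal (w k) \<noteq> \<infinity>" if "k \<in> A" for k
  proof -
    have "ennreal_powr (g k) p * ennreal (w k) \<le> (\<Sum>k\<in>A. ennreal_powr (g k) p * ennreal (w k))"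
      using fin that by (intro member_le_sum) auto
    with g show ?thesis by (auto simp: top_unique)
  qed
  have w_pos: "0 < w k" if k: "k \<in> A" and "f k \<noteq> 0" for k
  proof (rule ccontr)
    assume "\<not> 0 < w k"
    with w[OF k] have "w k = 0" by simp
    then have "ennreal_powr (ennreal (w k)) (1 - q) = \<infinity>" using q by (simp add: ennreal_powr_def)
    moreover have "ennreal_powr (f k) q \<noteq> 0"
      using that q0' by (cases "f k") (auto simp: ennreal_powr_def)
    ultimately show False using fin_f[OF k] by (simp add: ennreal_mult_eq_top_iff)
  qed
  have fk: "f k \<noteq> \<infinity>" if k: "k \<in> A" and "f k \<noteq> 0" for k
  proof
    assume "f k = \<infinity>"
    then show False
      using fin_f[OF k] ennreal_powr_neg_pos[of "ennreal (w k)" "1 - q"] q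
      by (simp add: ennreal_powr_top ennreal_mult_eq_top_iff zero_less_iff_neq_zero)
  qed
  have gk: "g k \<noteq> \<infinity>" if k: "k \<in> A" and "f k \<noteq> 0" for k
  proof
    assume "g k = \<infinity>"
    then show False
      using fin_g[OF k] w_pos[OF that] p by (auto simp: ennreal_powr_top ennreal_mult_eq_top_iff)
  qed
  \<comment> \<open>Where \<open>f\<close> vanishes both factors are set to 0, so an infinite
    \<open>g k\<close> or a zero weight does no harm there. The price is that
    \<open>y k powr p\<close> is only bounded by the weighted power of \<open>g k\<close>.\<close>
  define x where "x k = (if f k = 0 then 0 else enn2real (f k) * w k powr (- (1 / p)))" for k
  define y where "y k = (if f k = 0 then 0 else enn2real (g k) * w k powr (1 / p))" for k
  have xy: "f k * g k = ennreal (x k * y k)" if k: "k \<in> A" for k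
  proof (cases "f k = 0")
    case True
    then show ?thesis by (simp add: x_def)
  next
    case nz: False
    obtain r s where rs: "f k = ennreal r" "0 \<le> r" "g k = ennreal s" "0 \<le> s"
      using fk[OF k nz] gk[OF k nz] by (metis ennreal_cases infinity_ennreal_def)
    have "x k * y k = r * s * (w k powr (- (1 / p)) * w k powr (1 / p))"
      using nz rs by (simp add: x_def y_def)
    also have "\<dots> = r * s"
      using w_pos[OF k nz] by (simp flip: powr_add)
    finally show ?thesis using rs by (simp add: ennreal_mult)
  qed
  have xq: "ennreal_powr (f k) q * ennreal_powr (ennreal (w k)) (1 - q) = ennreal (x k powr q)"
    if k: "k \<in> A" for k
  proof (cases "f k = 0")
    case True
    then show ?thesis using q by (simp add: x_def ennreal_powr_def)
  next
    case nz: False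
    obtain r where r: "f k = ennreal r" "0 \<le> r"
      using fk[OF k nz] by (metis ennreal_cases infinity_ennreal_def)
    with nz have "0 < r" by (cases "r = 0") auto
    have "x k = r * w k powr (- (1 / p))" using nz r by (simp add: x_def)
    then have "x k powr q = r powr q * w k powr (1 - q)"
      using r by (simp add: powr_mult powr_powr qp)
    moreover have "ennreal_powr (f k) q = ennreal (r powr q)"
      using r \<open>0 < r\<close> by (simp add: ennreal_powr_ennreal)
    moreover have "ennreal_powr (ennreal (w k)) (1 - q) = ennreal (w k powr (1 - q))"
      using w_pos[OF k nz] by (simp add: ennreal_powr_ennreal)
    ultimately show ?thesis by (simp add: ennreal_mult)
  qed
  have yp: "ennreal (y k powr p) \<le> ennreal_powr (g k) p * ennreal (w k)" if k: "k \<in> A" for k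
  proof (cases "f k = 0")
    case True
    then show ?thesis by (simp add: y_def)
  next
    case nz: False
    obtain s where s: "g k = ennreal s" "0 \<le> s"
      using gk[OF k nz] by (metis ennreal_cases infinity_ennreal_def)
    have "y k = s * w k powr (1 / p)" using nz s by (simp add: y_def)
    then have "y k powr p = s powr p * w k"
      using s p w_pos[OF k nz] by (simp add: powr_mult powr_powr)
    moreover have "ennreal_powr (g k) p = ennreal (s powr p)"
      using s p ennreal_powr_ennreal[of s p] by (auto simp: order_le_less)
    ultimately show ?thesis using w_pos[OF k nz] by (simp add: ennreal_mult)
  qed
  have x0: "0 \<le> x k" and y0: "0 \<le> y k" for k by (auto simp: x_def y_def)
  have "ennreal (\<Sum>k\<in>A. y k powr p) = (\<Sum>k\<in>A. ennreal (y k powr p))" by simp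
  also have "\<dots> \<le> (\<Sum>k\<in>A. ennreal_powr (g k) p * ennreal (w k))" by (intro sum_mono yp)
  also note g
  finally have Y: "(\<Sum>k\<in>A. y k powr p) \<le> 1" by simp
  have "(\<Sum>k\<in>A. x k * y k) \<le> (\<Sum>k\<in>A. x k powr q) powr (1 / q) * (\<Sum>k\<in>A. y k powr p) powr (1 / p)"
    using fin q pq x0 y0 by (intro Holder_sum_real) auto
  also have "\<dots> \<le> (\<Sum>k\<in>A. x k powr q) powr (1 / q) * 1"
    using Y p sum_nonneg[of A "\<lambda>k. y k powr p"]
    by (intro mult_left_mono powr_le1) (auto simp: sum_nonneg)
  finally have "(\<Sum>k\<in>A. x k * y k) \<le> (\<Sum>k\<in>A. x k powr q) powr (1 / q)" by simp
  then have "ennreal (\<Sum>k\<in>A. x k * y k) \<le> ennreal_powr (ennreal (\<Sum>k\<in>A. x k powr q)) (1 / q)"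
    using q0 sum_nonneg[of A "\<lambda>k. x k powr q"]
    by (subst ennreal_powr_ennreal) (auto simp: less_le)
  then show ?thesis
    using x0 y0 by (simp add: xy xq)
qed

text \<open>Abel summation without negative terms: subtracting the last coefficient from all others
  leaves a nonincreasing sequence for the induction hypothesis, plus a multiple of the full partial
  sums. It serves to exchange one weight for another by comparing partial sums only.\<close>

lemma sum_mult_le_antimono:
  fixes a x y :: "nat \<Rightarrow> ennreal"
  assumes "antimono a" and "\<And>m. m \<le> n \<Longrightarrow> (\<Sum>k\<le>m. x k) \<le> (\<Sum>k\<le>m. y k)"
  shows "(\<Sum>k\<le>n. a k * x k) \<le> (\<Sum>k\<le>n. a k * y k)"
  using assms
proof (induction n arbitrary: a)
  case 0
  then show ?case by (auto intro: mult_left_mono)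
next
  case (Suc n)
  let ?t = "a (Suc n)"
  have split: "(\<Sum>k\<le>Suc n. a k * z k) = (\<Sum>k\<le>n. (a k - ?t) * z k) + ?t * (\<Sum>k\<le>Suc n. z k)"
    for z :: "nat \<Rightarrow> ennreal"
  proof -
    have "a k * z k = (a k - ?t) * z k + ?t * z k" if "k \<le> n" for k
      using antimonoD[OF Suc.prems(1), of k "Suc n"] that
      by (simp add: diff_add_cancel_ennreal flip: distrib_right)
    then show ?thesis by (simp add: sum.distrib sum_distrib_left distrib_left add.assoc)
  qed
  have "antimono (\<lambda>k. a k - ?t)"
    using Suc.prems(1) by (auto simp: antimono_def intro: ennreal_minus_mono)
  then have "(\<Sum>k\<le>n. (a k - ?t) * x k) \<le> (\<Sum>k\<le>n. (a k - ?t) * y k)"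
    using Suc.prems(2) by (intro Suc.IH) auto
  then show ?case
    unfolding split using Suc.prems(2)[of "Suc n"] by (intro add_mono mult_left_mono) auto
qed

subsection \<open>Nonincreasing rearrangements\<close>

lemma rearrangement_antimono: "antimono (rearrangement f)"
proof (rule antimonoI)
  fix m n :: nat
  assume "m \<le> n"
  then have "(of_nat m :: ennreal) \<le> of_nat n" by simp
  then show "rearrangement f n \<le> rearrangement f m"
    unfolding rearrangement_def by (intro Inf_superset_mono) (blast intro: order_trans)
qed

lemma rearrangement_ge:
  assumes A: "finite A" "n < card A" and le: "\<And>k. k \<in> A \<Longrightarrow> t \<le> norm (f k)"
  shows "ennreal t \<le> rearrangement f n"
  unfolding rearrangement_def
proof (rule Inf_greatest, safe)
  fix s :: real
  assume s: "0 < s" and em: "emeasure (count_space UNIV) {k. s < norm (f k)} \<le> of_nat n"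
  show "ennreal t \<le> ennreal s"
  proof (rule ccontr)
    assume "\<not> ennreal t \<le> ennreal s"
    then have "s < t" using ennreal_leI[of t s] by force
    then have sub: "A \<subseteq> {k. s < norm (f k)}" using le by force
    have "of_nat (card A) = emeasure (count_space UNIV) A"
      using A by simp
    also have "\<dots> \<le> emeasure (count_space UNIV) {k. s < norm (f k)}"
      using sub by (intro emeasure_mono) auto
    also note em
    finally show False using A by simp
  qed
qed

text \<open>The infimum runs over positive levels while \<open>t\<close> may be 0; hence the detour
  through the levels \<open>t + e\<close>.\<close>

lemma rearrangement_le:
  assumes A: "finite A" "card A \<le> n" and t: "0 \<le> t" and le: "\<And>k. k \<notin> A \<Longrightarrow> norm (f k) \<le> t"
  shows "rearrangement f n \<le> ennreal t"
proof (rule ennreal_le_epsilon)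
  fix e :: real
  assume e: "0 < e"
  have "{k. t + e < norm (f k)} \<subseteq> A" using le e by force
  then have "emeasure (count_space UNIV) {k. t + e < norm (f k)} \<le> emeasure (count_space UNIV) A"
    by (intro emeasure_mono) auto
  also have "\<dots> \<le> of_nat n" using A by simp
  finally have "rearrangement f n \<le> ennreal (t + e)"
    unfolding rearrangement_def using t e by (intro Inf_lower CollectI exI[of _ "t + e"]) auto
  then show "rearrangement f n \<le> ennreal t + ennreal e" using t e by simp
qed

text \<open>Otherwise the level set itself could serve as the exceptional set in
  \<open>rearrangement_le\<close>. The infinite case stands apart because \<open>card\<close> is 0
  there.\<close>

lemma many_above_level:
  assumes "ennreal t < rearrangement f n" "0 < t"
  shows "infinite {k. t < norm (f k)} \<or> n < card {k. t < norm (f k)}"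
proof (rule ccontr)
  assume *: "\<not> ?thesis"
  then have "rearrangement f n \<le> ennreal t"
    using assms(2) by (intro rearrangement_le[of "{k. t < norm (f k)}"]) auto
  with assms(1) show False by simp
qed

lemma decreasing_enumeration:
  fixes u :: "'a \<Rightarrow> real"
  assumes "finite A"
  shows "\<exists>\<sigma>. bij_betw \<sigma> {..<card A} A \<and> (\<forall>i j. i \<le> j \<longrightarrow> j < card A \<longrightarrow> u (\<sigma> j) \<le> u (\<sigma> i))"
proof -
  obtain xs where xs: "set xs = A" "distinct xs" using assms finite_distinct_list by blast
  define ys where "ys = sort_key (\<lambda>k. - u k) xs"
  have ys: "set ys = A" "distinct ys" using xs by (auto simp: ys_def)
  then have len: "length ys = card A" by (metis distinct_card)
  have "sorted (map (\<lambda>k. - u k) ys)" by (simp add: ys_def)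
  then have "u (ys ! j) \<le> u (ys ! i)" if "i \<le> j" "j < card A" for i j
    using sorted_nth_mono[of "map (\<lambda>k. - u k) ys" i j] that len by simp
  moreover have "bij_betw (\<lambda>i. ys ! i) {..<card A} A"
    by (rule bij_betw_nth) (simp_all only: ys len)
  ultimately show ?thesis by blast
qed

text \<open>The \<open>n + 1\<close> distinct indices \<sigma> 0, ..., \<sigma> n all carry values
  at least as large as the one at \<sigma> n.\<close>

lemma norm_decreasing_enumeration_le:
  assumes "bij_betw \<sigma> {..<m} A" and dec: "\<And>i j. i \<le> j \<Longrightarrow> j < m \<Longrightarrow> norm (f (\<sigma> j)) \<le> norm (f (\<sigma> i))"
    and "n < m"
  shows "ennreal (norm (f (\<sigma> n))) \<le> rearrangement f n"
proof (rule rearrangement_ge)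
  have "inj_on \<sigma> {..<m}" using assms(1) by (rule bij_betw_imp_inj_on)
  then have "inj_on \<sigma> {..n}" by (rule inj_on_subset) (use assms(3) in auto)
  then show "n < card (\<sigma> ` {..n})" by (simp add: card_image)
qed (use assms in auto)

lemma sum_norm_le_rearrangement:
  assumes "finite A"
  shows "(\<Sum>k\<in>A. ennreal (norm (f k))) \<le> (\<Sum>n<card A. rearrangement f n)"
proof -
  obtain \<sigma> where \<sigma>: "bij_betw \<sigma> {..<card A} A"
    "\<And>i j. i \<le> j \<Longrightarrow> j < card A \<Longrightarrow> norm (f (\<sigma> j)) \<le> norm (f (\<sigma> i))"
    using decreasing_enumeration[OF assms, of "\<lambda>k. norm (f k)"] by blast
  have "(\<Sum>k\<in>A. ennreal (norm (f k))) = (\<Sum>n<card A. ennreal (norm (f (\<sigma> n))))"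
    using sum.reindex_bij_betw[OF \<sigma>(1), of "\<lambda>k. ennreal (norm (f k))"] by simp
  also have "\<dots> \<le> (\<Sum>n<card A. rearrangement f n)"
    using \<sigma> by (intro sum_mono norm_decreasing_enumeration_le) auto
  finally show ?thesis .
qed

text \<open>Along an enumeration of \<open>A\<close> by decreasing |f| the factor |f| is at most f*
  term by term. As f* is nonincreasing, only the partial sums of |g| matter after that, and these
  are at most those of g*.\<close>

lemma Hardy_Littlewood:
  assumes "finite A"
  shows "(\<Sum>k\<in>A. ennreal (norm (f k * g k))) \<le> (\<Sum>n<card A. rearrangement f n * rearrangement g n)"
proof (cases "card A")
  case 0
  then show ?thesis using assms by simp
next
  case (Suc m)
  obtain \<sigma> where \<sigma>: "bij_betw \<sigma> {..<card A} A"
    "\<And>i j. i \<le> j \<Longrightarrow> j < card A \<Longrightarrow> norm (f (\<sigma> j)) \<le> norm (f (\<sigma> i))"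
    using decreasing_enumeration[OF assms, of "\<lambda>k. norm (f k)"] by blast
  have inj: "inj_on \<sigma> {..m}"
    using bij_betw_imp_inj_on[OF \<sigma>(1)] by (rule inj_on_subset) (auto simp: Suc)
  have "(\<Sum>k\<in>A. ennreal (norm (f k * g k))) = (\<Sum>n<card A. ennreal (norm (f (\<sigma> n) * g (\<sigma> n))))"
    using sum.reindex_bij_betw[OF \<sigma>(1), of "\<lambda>k. ennreal (norm (f k * g k))"] by simp
  also have "\<dots> = (\<Sum>n<card A. ennreal (norm (f (\<sigma> n))) * ennreal (norm (g (\<sigma> n))))"
    by (simp add: norm_mult ennreal_mult)
  also have "\<dots> \<le> (\<Sum>n<card A. rearrangement f n * ennreal (norm (g (\<sigma> n))))"
    using \<sigma> by (intro sum_mono mult_right_mono norm_decreasing_enumeration_le) auto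
  also have "\<dots> = (\<Sum>n\<le>m. rearrangement f n * ennreal (norm (g (\<sigma> n))))"
    by (simp add: Suc lessThan_Suc_atMost)
  also have "\<dots> \<le> (\<Sum>n\<le>m. rearrangement f n * rearrangement g n)"
  proof (rule sum_mult_le_antimono[OF rearrangement_antimono])
    fix l assume "l \<le> m"
    with inj have inj': "inj_on \<sigma> {..l}" by (auto intro: inj_on_subset)
    have "(\<Sum>n\<le>l. ennreal (norm (g (\<sigma> n)))) = (\<Sum>k\<in>\<sigma> ` {..l}. ennreal (norm (g k)))"
      using inj' by (simp add: sum.reindex)
    also have "\<dots> \<le> (\<Sum>n<card (\<sigma> ` {..l}). rearrangement g n)"
      by (intro sum_norm_le_rearrangement) auto
    finally show "(\<Sum>n\<le>l. ennreal (norm (g (\<sigma> n)))) \<le> (\<Sum>n\<le>l. rearrangement g n)"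
      using inj' by (simp add: card_image lessThan_Suc_atMost)
  qed
  finally show ?thesis by (simp add: Suc lessThan_Suc_atMost)
qed

text \<open>Greedy choice: more than \<open>N\<close> indices reach the level \<open>r N\<close>
  (all of them if it is 0), so one is still free after \<open>N\<close> choices. Strictness of
  \<open>r n\<close> below the rearrangement makes attainment of f* irrelevant.\<close>

lemma exists_injection_above:
  assumes "\<And>n. n < N \<Longrightarrow> r n = 0 \<or> (0 < r n \<and> ennreal (r n) < rearrangement f n)"
  shows "\<exists>\<sigma>. inj_on \<sigma> {..<N} \<and> (\<forall>n<N. r n \<le> norm (f (\<sigma> n)))"
  using assms
proof (induction N)
  case 0
  then show ?case by simp
next
  case (Suc N)
  then obtain \<sigma> where \<sigma>: "inj_on \<sigma> {..<N}" "\<And>n. n < N \<Longrightarrow> r n \<le> norm (f (\<sigma> n))"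
    by auto
  define B where "B = {k. r N \<le> norm (f k)}"
  have "\<not> B \<subseteq> \<sigma> ` {..<N}"
  proof
    assume sub: "B \<subseteq> \<sigma> ` {..<N}"
    then have fin: "finite B" by (auto intro: finite_subset)
    show False
    proof (cases "r N = 0")
      case True
      then have "B = UNIV" by (simp add: B_def)
      with fin show False by simp
    next
      case False
      have sub': "{k. r N < norm (f k)} \<subseteq> B" by (auto simp: B_def)
      with fin have "N < card {k. r N < norm (f k)}"
        using False Suc.prems[of N] many_above_level[of "r N" f N] finite_subset by blast
      also have "\<dots> \<le> card B" using fin sub' by (rule card_mono)
      also have "\<dots> \<le> card (\<sigma> ` {..<N})" using sub by (intro card_mono) auto
      also have "\<dots> \<le> N" using card_image_le[of "{..<N}" \<sigma>] by simp
      finally show False by simp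
    qed
  qed
  then obtain k where k: "k \<in> B" "k \<notin> \<sigma> ` {..<N}" by blast
  have "inj_on (\<sigma>(N := k)) {..<Suc N}"
    using \<sigma>(1) k(2) by (auto simp: lessThan_Suc inj_on_def)
  moreover have "r n \<le> norm (f ((\<sigma>(N := k)) n))" if "n < Suc N" for n
    using that \<sigma>(2)[of n] k(1) by (auto simp: B_def less_Suc_eq)
  ultimately show ?case by blast
qed

lemma sum_mult_by_parts:
  fixes x a :: "nat \<Rightarrow> real"
  shows "(\<Sum>k\<le>n. x k * a k) = (\<Sum>k\<le>n. (\<Sum>j\<le>k. x j) * (a k - a (Suc k))) + (\<Sum>j\<le>n. x j) * a (Suc n)"
  by (induction n) (auto simp: algebra_simps)

subsection \<open>The associate norm\<close>

locale lorentz_weight =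
  fixes p q :: real and \<Omega> :: "nat \<Rightarrow> real"
  assumes p: "1 < p" and pq: "1 / p + 1 / q = 1"
    and \<Omega>_nonneg: "0 \<le> \<Omega> n" and \<Omega>_0: "\<Omega> 0 \<noteq> 0"
begin

lemma q: "1 < q"
  using p pq by (rule conjugate_exponent_gt_one)

lemma mult_eq_add: "p * q = p + q"
  using pq p q by (simp add: field_simps)

lemma conj_mult: "(q - 1) * p = q" "p - p / q = 1"
  using mult_eq_add p q by (simp_all add: field_simps)

definition W :: "nat \<Rightarrow> real" where "W n = (\<Sum>k\<le>n. \<Omega> k)"

abbreviation c :: "nat \<Rightarrow> real" where "c \<equiv> discrete_hardy \<Omega>"

abbreviation N :: "(nat \<Rightarrow> complex) \<Rightarrow> ennreal" where
  "N \<equiv> associate_norm (lorentz_norm (\<lambda>n. ennreal (\<Omega> n)) p)"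

abbreviation V :: "nat \<Rightarrow> ennreal" where
  "V n \<equiv> ennreal_powr (ennreal (\<Omega> n)) (1 - q)"

abbreviation M :: "(nat \<Rightarrow> complex) \<Rightarrow> ennreal" where "M \<equiv> lorentz_norm V q"

lemma \<Omega>_0_pos: "0 < \<Omega> 0"
  using \<Omega>_nonneg[of 0] \<Omega>_0 by simp

lemma W_mono: "m \<le> n \<Longrightarrow> W m \<le> W n"
  unfolding W_def by (intro sum_mono2) (auto simp: \<Omega>_nonneg)

lemma W_pos: "0 < W n"
  using W_mono[of 0 n] \<Omega>_0_pos by (simp add: W_def)

lemma c_eq: "c n = W n / (real n + 1)"
  by (simp add: discrete_hardy_def W_def add.commute)

lemma c_pos: "0 < c n"
  using W_pos[of n] by (simp add: c_eq)

lemma powr_c: "ennreal_powr (ennreal (c n)) (1 - q) = ennreal (c n powr (1 - q))"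
  using c_pos by (simp add: ennreal_powr_ennreal)

text \<open>Since (q - 1) p = q, the power y^(q-1) is the factor for which Young's inequality yields
  y^q.\<close>

lemma Young: "0 \<le> x \<Longrightarrow> 0 \<le> y \<Longrightarrow> x * y powr (q - 1) \<le> x powr q / q + y powr q / p"
  using Youngs_inequality[of q p x "y powr (q - 1)"] p q pq conj_mult
  by (simp add: powr_powr add.commute)

lemma lorentz_norm_le_one_iff:
  "lorentz_norm w p g \<le> 1 \<longleftrightarrow> (\<Sum>n. ennreal_powr (rearrangement g n) p * w n) \<le> 1"
proof
  assume "lorentz_norm w p g \<le> 1"
  then have "ennreal_powr (lorentz_norm w p g) p \<le> ennreal_powr 1 p"
    using p by (intro ennreal_powr_mono) auto
  then show "(\<Sum>n. ennreal_powr (rearrangement g n) p * w n) \<le> 1"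
    using p by (simp add: lorentz_norm_def ennreal_powr_powr)
next
  assume "(\<Sum>n. ennreal_powr (rearrangement g n) p * w n) \<le> 1"
  then have "lorentz_norm w p g \<le> ennreal_powr 1 (1 / p)"
    unfolding lorentz_norm_def using p by (intro ennreal_powr_mono) auto
  then show "lorentz_norm w p g \<le> 1" by simp
qed

text \<open>Both inequalities, Hardy-Littlewood and weighted Hoelder, are applied to finite sums
  before passing to the series.\<close>

lemma associate_norm_le: "N f \<le> M f"
  unfolding associate_norm_def
proof (intro SUP_least suminf_le_ennreal)
  fix g n
  assume "g \<in> {g. lorentz_norm (\<lambda>n. ennreal (\<Omega> n)) p g \<le> 1}"
  then have g: "(\<Sum>n. ennreal_powr (rearrangement g n) p * ennreal (\<Omega> n)) \<le> 1"
    by (simp add: lorentz_norm_le_one_iff)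
  have "(\<Sum>k\<le>n. ennreal (norm (f k * g k))) \<le> (\<Sum>k\<le>n. rearrangement f k * rearrangement g k)"
    using Hardy_Littlewood[of "{..n}" f g] by (simp add: lessThan_Suc_atMost)
  also have "\<dots> \<le> ennreal_powr (\<Sum>k\<le>n. ennreal_powr (rearrangement f k) q * V k) (1 / q)"
    using p pq \<Omega>_nonneg g by (intro weighted_Holder[where p = p])
      (auto intro: order_trans[OF sum_le_suminf_ennreal])
  also have "\<dots> \<le> M f"
    unfolding lorentz_norm_def using q by (intro ennreal_powr_mono sum_le_suminf_ennreal) auto
  finally show "(\<Sum>k\<le>n. ennreal (norm (f k * g k))) \<le> M f" .
qed

section \<open>Necessity: both norms on characteristic functions of initial segments\<close>

text \<open>For \<open>a = 0\<close> this is a discrete form of the integral of x^(q-1) being x^q /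
  q. Raising \<open>b\<close> by one increases the left side by at most the new term on the
  right.\<close>

lemma sum_powr_ge:
  assumes "a \<le> b"
  shows "(real b + 1 - real a) * (real b + 1) powr (q - 1) \<le> q * (\<Sum>k=a..b. (real k + 1) powr (q - 1))"
  using assms
proof (induction rule: dec_induct)
  case base
  then show ?case using q by simp
next
  case (step b)
  let ?x = "real b + 1" and ?y = "real b + 2"
  have split: "z * z powr (q - 1) = z powr q" if "0 \<le> z" for z :: real
    using that powr_mult_base[of z "q - 1"] by simp
  have "?x * ?y powr (q - 1) \<le> ?x powr q / q + ?y powr q / p"
    by (rule Young) auto
  then have "q * (?x * ?y powr (q - 1)) \<le> q * (?x powr q / q + ?y powr q / p)"
    using q by (intro mult_left_mono) auto
  also have "\<dots> = ?x powr q + (q / p) * ?y powr q"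
    using q by (simp add: distrib_left)
  also have "\<dots> = ?x * ?x powr (q - 1) + (q - 1) * (?y * ?y powr (q - 1))"
    using conj_mult(1) p by (simp add: split nonzero_divide_eq_eq)
  finally have "?x * (?y powr (q - 1) - ?x powr (q - 1)) \<le> (q - 1) * ?y powr (q - 1)"
    by (simp add: algebra_simps)
  \<comment> \<open>The difference of powers is nonnegative, so the case \<open>a = 0\<close> is the
    worst one.\<close>
  moreover have "(?x - real a) * (?y powr (q - 1) - ?x powr (q - 1))
      \<le> ?x * (?y powr (q - 1) - ?x powr (q - 1))"
    using q by (intro mult_right_mono) (auto intro!: powr_mono2)
  ultimately have "(?y - real a) * ?y powr (q - 1) - (?x - real a) * ?x powr (q - 1) \<le> q * ?y powr (q - 1)"
    by (simp add: algebra_simps)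
  then show ?case
    using step by (simp add: algebra_simps)
qed

text \<open>As \<open>W\<close> increases, c(k) <= c(b) (b+1)/(k+1) for k <= b. With the negative
  exponent 1 - q this bounds each summand below by (k+1)^(q-1) times the constant \<open>?B\<close>,
  and \<open>sum_powr_ge\<close> does the rest.\<close>

lemma hardy_powr_block_le:
  assumes "a \<le> b"
  shows "(real b + 1 - real a) * c b powr (1 - q) \<le> q * (\<Sum>k=a..b. c k powr (1 - q))"
proof -
  let ?B = "c b powr (1 - q) / (real b + 1) powr (q - 1)"
  have le: "(real k + 1) powr (q - 1) * ?B \<le> c k powr (1 - q)" if "k \<le> b" for k
  proof -
    have "c k \<le> W b / (real k + 1)"
      using W_mono[OF that] by (simp add: c_eq divide_right_mono)
    also have "\<dots> = c b * ((real b + 1) / (real k + 1))" by (simp add: c_eq)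
    finally have "(c b * ((real b + 1) / (real k + 1))) powr (1 - q) \<le> c k powr (1 - q)"
      using c_pos[of k] q by (intro powr_mono2') auto
    moreover have "(c b * ((real b + 1) / (real k + 1))) powr (1 - q) = (real k + 1) powr (q - 1) * ?B"
    proof -
      have *: "s powr (1 - q) = 1 / s powr (q - 1)" for s :: real
        using powr_minus_divide[of s "q - 1"] by simp
      have "(c b * ((real b + 1) / (real k + 1))) powr (1 - q)
          = c b powr (1 - q) * ((real b + 1) powr (1 - q) / (real k + 1) powr (1 - q))"
        using c_pos[of b] by (simp only: powr_mult powr_divide)
      then show ?thesis by (simp only: *[of "real b + 1"] *[of "real k + 1"]) simp
    qed
    ultimately show ?thesis by simp
  qed
  have "(real b + 1 - real a) * c b powr (1 - q) = (real b + 1 - real a) * (real b + 1) powr (q - 1) * ?B"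
    by simp
  also have "\<dots> \<le> q * (\<Sum>k=a..b. (real k + 1) powr (q - 1)) * ?B"
    using assms by (intro mult_right_mono sum_powr_ge) auto
  also have "\<dots> = q * (\<Sum>k=a..b. (real k + 1) powr (q - 1) * ?B)"
    by (simp only: sum_distrib_right mult.assoc)
  also have "\<dots> \<le> q * (\<Sum>k=a..b. c k powr (1 - q))"
    using q le by (intro mult_left_mono sum_mono) auto
  finally show ?thesis .
qed

text \<open>Among the weights whose partial sums are dominated by those of \<open>\<Omega>\<close> on \<open>{..n}\<close>, this one is so
  evenly spread that Hoelder's inequality with it is sharp, up to a constant, on the characteristic
  function of \<open>{..n}\<close>.\<close>

definition u :: "nat \<Rightarrow> nat \<Rightarrow> real" where "u n k = Min (c ` {k..n})"

lemma u_pos: "k \<le> n \<Longrightarrow> 0 < u n k"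
  unfolding u_def by (subst Min_gr_iff) (auto simp: c_pos)

lemma u_le: "k \<le> m \<Longrightarrow> m \<le> n \<Longrightarrow> u n k \<le> c m"
  unfolding u_def by (intro Min_le) auto

lemma sum_u_le: "m \<le> n \<Longrightarrow> (\<Sum>k\<le>m. u n k) \<le> W m"
proof -
  assume "m \<le> n"
  then have "(\<Sum>k\<le>m. u n k) \<le> (\<Sum>k\<le>m. c m)" by (intro sum_mono u_le) auto
  then show ?thesis by (simp add: c_eq add.commute)
qed

text \<open>Up to a point \<open>m\<close> where \<open>c\<close> is minimal on
  \<open>{a..n}\<close>, \<open>u n\<close> is constantly \<open>c m\<close>, so the block estimate
  applies; the rest \<open>{Suc m..n}\<close> is an instance of the same claim. The left end
  \<open>a\<close> is left free for this recursion.\<close>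

lemma sum_powr_u_le:
  assumes "a \<le> n"
  shows "(\<Sum>k=a..n. u n k powr (1 - q)) \<le> q * (\<Sum>k=a..n. c k powr (1 - q))"
  using assms
proof (induction "n - a" arbitrary: a rule: less_induct)
  case less
  have "Min (c ` {a..n}) \<in> c ` {a..n}" using less.prems by (intro Min_in) auto
  then obtain m where m: "a \<le> m" "m \<le> n" "c m = Min (c ` {a..n})" by auto
  have "u n k = c m" if "a \<le> k" "k \<le> m" for k
    unfolding u_def
  proof (rule Min_eqI)
    fix x assume "x \<in> c ` {k..n}"
    then show "c m \<le> x" using that unfolding m(3) by (intro Min_le) auto
  next
    show "c m \<in> c ` {k..n}" using that m(2) by (intro imageI) auto
  qed simp
  then have "(\<Sum>k=a..m. u n k powr (1 - q)) = (real m + 1 - real a) * c m powr (1 - q)"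
    using m(1) by (simp add: of_nat_diff)
  also have "\<dots> \<le> q * (\<Sum>k=a..m. c k powr (1 - q))" using m(1) by (rule hardy_powr_block_le)
  finally have 1: "(\<Sum>k=a..m. u n k powr (1 - q)) \<le> q * (\<Sum>k=a..m. c k powr (1 - q))" .
  have 2: "(\<Sum>k=Suc m..n. u n k powr (1 - q)) \<le> q * (\<Sum>k=Suc m..n. c k powr (1 - q))"
  proof (cases "m = n")
    case False
    with m show ?thesis by (intro less.hyps) auto
  qed simp
  have "{a..n} = {a..m} \<union> {Suc m..n}" using m by auto
  then have split: "sum z {a..n} = sum z {a..m} + sum z {Suc m..n}" for z :: "nat \<Rightarrow> real"
    by (simp add: sum.union_disjoint)
  show ?case unfolding split using 1 2 by (simp add: algebra_simps)
qed

text \<open>The rearrangement being nonincreasing, the norm constraint persists when \<Omega> is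
  replaced by \<open>u n\<close>, whose partial sums are smaller. Hoelder with this weight against
  the constant 1 gives the bound.\<close>

lemma sum_rearrangement_le:
  assumes "lorentz_norm (\<lambda>n. ennreal (\<Omega> n)) p g \<le> 1"
  shows "(\<Sum>k\<le>n. rearrangement g k) \<le> ennreal_powr (ennreal (q * (\<Sum>k\<le>n. c k powr (1 - q)))) (1 / q)"
proof -
  have anti: "antimono (\<lambda>k. ennreal_powr (rearrangement g k) p)"
    using p rearrangement_antimono[of g] by (auto simp: antimono_def intro: ennreal_powr_mono)
  have "(\<Sum>k\<le>m. ennreal (u n k)) \<le> (\<Sum>k\<le>m. ennreal (\<Omega> k))" if "m \<le> n" for m
  proof -
    have "(\<Sum>k\<le>m. ennreal (u n k)) = ennreal (\<Sum>k\<le>m. u n k)"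
      using that u_pos by (intro sum_ennreal) (auto intro: less_imp_le)
    also have "\<dots> \<le> ennreal (W m)" using sum_u_le[OF that] by (rule ennreal_leI)
    also have "\<dots> = (\<Sum>k\<le>m. ennreal (\<Omega> k))" using \<Omega>_nonneg by (simp add: W_def)
    finally show ?thesis .
  qed
  then have "(\<Sum>k\<le>n. ennreal_powr (rearrangement g k) p * ennreal (u n k))
    \<le> (\<Sum>k\<le>n. ennreal_powr (rearrangement g k) p * ennreal (\<Omega> k))"
    by (intro sum_mult_le_antimono[OF anti])
  also have "\<dots> \<le> (\<Sum>k. ennreal_powr (rearrangement g k) p * ennreal (\<Omega> k))"
    by (rule sum_le_suminf_ennreal) simp
  also have "\<dots> \<le> 1" using assms by (simp add: lorentz_norm_le_one_iff)
  finally have "(\<Sum>k\<le>n. 1 * rearrangement g k)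
    \<le> ennreal_powr (\<Sum>k\<le>n. ennreal_powr 1 q * ennreal_powr (ennreal (u n k)) (1 - q)) (1 / q)"
    using p pq u_pos by (intro weighted_Holder[where p = p]) (auto intro: less_imp_le)
  also have "(\<Sum>k\<le>n. ennreal_powr 1 q * ennreal_powr (ennreal (u n k)) (1 - q)) = ennreal (\<Sum>k\<le>n. u n k powr (1 - q))"
    using u_pos by (simp add: ennreal_powr_ennreal)
  also have "ennreal_powr \<dots> (1 / q) \<le> ennreal_powr (ennreal (q * (\<Sum>k\<le>n. c k powr (1 - q)))) (1 / q)"
    using q sum_powr_u_le[of 0 n] by (intro ennreal_powr_mono ennreal_leI) (auto simp: atLeast0AtMost)
  finally show ?thesis by simp
qed

lemma associate_norm_indicator_le:
  "N (\<lambda>k. if k \<le> n then 1 else 0) \<le> ennreal_powr (ennreal (q * (\<Sum>k\<le>n. c k powr (1 - q)))) (1 / q)"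
  unfolding associate_norm_def
proof (intro SUP_least suminf_le_ennreal)
  fix g m
  assume "g \<in> {g. lorentz_norm (\<lambda>n. ennreal (\<Omega> n)) p g \<le> 1}"
  then have g: "lorentz_norm (\<lambda>n. ennreal (\<Omega> n)) p g \<le> 1" by simp
  have "(\<Sum>k\<le>m. ennreal (norm ((if k \<le> n then 1 else 0) * g k))) = (\<Sum>k\<le>m. if k \<le> n then ennreal (norm (g k)) else 0)"
    by (intro sum.cong) auto
  also have "\<dots> = (\<Sum>k\<in>{..m} \<inter> {k. k \<le> n}. ennreal (norm (g k)))"
    by (subst sum.If_cases) auto
  also have "\<dots> \<le> (\<Sum>k\<le>n. ennreal (norm (g k)))"
    by (intro sum_mono2) auto
  also have "\<dots> \<le> (\<Sum>k\<le>n. rearrangement g k)"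
    using sum_norm_le_rearrangement[of "{..n}" g] by (simp add: lessThan_Suc_atMost)
  also note sum_rearrangement_le[OF g]
  finally show "(\<Sum>k\<le>m. ennreal (norm ((if k \<le> n then 1 else 0) * g k)))
      \<le> ennreal_powr (ennreal (q * (\<Sum>k\<le>n. c k powr (1 - q)))) (1 / q)" .
qed

lemma lorentz_norm_indicator_ge:
  "ennreal_powr (\<Sum>k\<le>n. V k) (1 / q) \<le> M (\<lambda>k. if k \<le> n then 1 else 0)"
  unfolding lorentz_norm_def
proof (intro ennreal_powr_mono)
  let ?r = "rearrangement (\<lambda>k. if k \<le> n then 1 else 0)"
  have "1 \<le> ?r k" if "k \<le> n" for k
    using rearrangement_ge[of "{..n}" k 1 "\<lambda>k. if k \<le> n then 1 else 0"] that by simp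
  then have "V k \<le> ennreal_powr (?r k) q * V k" if "k \<le> n" for k
    using that q ennreal_powr_mono[of 1 "?r k" q] mult_right_mono[of 1 _ "V k"] by fastforce
  then have "(\<Sum>k\<le>n. V k) \<le> (\<Sum>k\<le>n. ennreal_powr (?r k) q * V k)"
    by (intro sum_mono) auto
  also have "\<dots> \<le> (\<Sum>k. ennreal_powr (?r k) q * V k)" by (rule sum_le_suminf_ennreal) simp
  finally show "(\<Sum>k\<le>n. V k) \<le> (\<Sum>k. ennreal_powr (?r k) q * V k)" .
qed (use q in simp)

section \<open>Sufficiency: lower bounds for the associate norm from test sequences\<close>

text \<open>The values of \<open>h\<close> are placed at distinct positions where |f| is at least
  \<open>r\<close>. The resulting \<open>g\<close> has rearrangement at most \<open>h\<close>, so it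
  is admissible in the supremum.\<close>

lemma associate_norm_ge:
  assumes h: "antimono h" "\<And>n. 0 \<le> h n" "\<And>n. m \<le> n \<Longrightarrow> h n = 0"
    and le_1: "(\<Sum>n<m. h n powr p * \<Omega> n) \<le> 1"
    and r: "\<And>n. n < m \<Longrightarrow> r n = 0 \<or> (0 < r n \<and> ennreal (r n) < rearrangement f n)"
  shows "ennreal (\<Sum>n<m. r n * h n) \<le> N f"
proof -
  obtain \<sigma> where \<sigma>: "inj_on \<sigma> {..<m}" "\<And>n. n < m \<Longrightarrow> r n \<le> norm (f (\<sigma> n))"
    using exists_injection_above[of m r f] r by blast
  define g :: "nat \<Rightarrow> complex" where
    "g k = (if k \<in> \<sigma> ` {..<m} then of_real (h (inv_into {..<m} \<sigma> k)) else 0)" for k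
  have g_\<sigma>: "g (\<sigma> n) = of_real (h n)" if "n < m" for n
    using that \<sigma>(1) by (simp add: g_def)
  \<comment> \<open>Once the first \<open>n\<close> chosen positions are removed, \<open>g\<close>
    only takes values \<open>h j\<close> with j >= n, or 0.\<close>
  have g_le: "rearrangement g n \<le> ennreal (h n)" for n
  proof (rule rearrangement_le)
    show "card (\<sigma> ` {..<min n m}) \<le> n"
      using card_image_le[of "{..<min n m}" \<sigma>] by simp
    show "norm (g k) \<le> h n" if k: "k \<notin> \<sigma> ` {..<min n m}" for k
    proof (cases "k \<in> \<sigma> ` {..<m}")
      case True
      then obtain j where j: "k = \<sigma> j" "j < m" by auto
      with k have "n \<le> j" by (cases "j < n") auto
      then show ?thesis using j h(2) antimonoD[OF h(1)] g_\<sigma>[OF j(2)] by simp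
    next
      case False
      then show ?thesis using h(2) by (simp add: g_def)
    qed
  qed (use h in auto)
  have powr_h: "ennreal_powr (ennreal (h n)) p = ennreal (h n powr p)" for n
    using p h(2)[of n] by (intro ennreal_powr_ennreal) auto
  have "(\<Sum>n. ennreal_powr (rearrangement g n) p * ennreal (\<Omega> n)) \<le> (\<Sum>n. ennreal (h n powr p * \<Omega> n))"
    using p \<Omega>_nonneg by (intro suminf_le)
      (auto simp: ennreal_mult powr_h[symmetric] intro!: mult_right_mono ennreal_powr_mono g_le)
  also have "\<dots> = (\<Sum>n<m. ennreal (h n powr p * \<Omega> n))"
    using h(3) by (intro suminf_finite) auto
  also have "\<dots> = ennreal (\<Sum>n<m. h n powr p * \<Omega> n)" using \<Omega>_nonneg by simp
  also have "\<dots> \<le> 1" using le_1 by simp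
  finally have "lorentz_norm (\<lambda>n. ennreal (\<Omega> n)) p g \<le> 1" by (simp add: lorentz_norm_le_one_iff)
  then have N: "(\<Sum>k. ennreal (norm (f k * g k))) \<le> N f"
    unfolding associate_norm_def by (intro SUP_upper) simp
  have "(\<Sum>n<m. r n * h n) \<le> (\<Sum>n<m. norm (f (\<sigma> n) * g (\<sigma> n)))"
    using \<sigma>(2) h(2) by (intro sum_mono) (auto simp: norm_mult g_\<sigma> intro: mult_right_mono)
  then have "ennreal (\<Sum>n<m. r n * h n) \<le> (\<Sum>n<m. ennreal (norm (f (\<sigma> n) * g (\<sigma> n))))"
    by (simp add: ennreal_leI)
  also have "\<dots> = (\<Sum>k\<in>\<sigma> ` {..<m}. ennreal (norm (f k * g k)))"
    using \<sigma>(1) by (simp add: sum.reindex)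
  also have "\<dots> \<le> (\<Sum>k. ennreal (norm (f k * g k)))"
    by (rule sum_le_suminf_ennreal) simp
  also note N
  finally show ?thesis .
qed

text \<open>\<open>H\<close> is merely an upper bound for the power sum, so the test sequence can be
  normalised without computing its norm.\<close>

lemma associate_norm_ge_scaled:
  assumes h: "antimono h" "\<And>n. 0 \<le> h n" "\<And>n. m \<le> n \<Longrightarrow> h n = 0"
    and H: "(\<Sum>n<m. h n powr p * \<Omega> n) \<le> H" "0 < H"
    and r: "\<And>n. n < m \<Longrightarrow> r n = 0 \<or> (0 < r n \<and> ennreal (r n) < rearrangement f n)"
  shows "ennreal ((\<Sum>n<m. r n * h n) / H powr (1 / p)) \<le> N f"
proof -
  have "(\<Sum>n<m. (h n / H powr (1 / p)) powr p * \<Omega> n) = (\<Sum>n<m. h n powr p * \<Omega> n) / H"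
    using p H(2) h(2) by (simp add: powr_divide powr_powr sum_divide_distrib)
  also have "\<dots> \<le> 1" using H by simp
  finally have "ennreal (\<Sum>n<m. r n * (h n / H powr (1 / p))) \<le> N f"
    using h by (intro associate_norm_ge[OF _ _ _ _ r]) (auto simp: antimono_def divide_right_mono)
  then show ?thesis by (simp add: sum_divide_distrib)
qed

text \<open>If \<open>f\<close> were unbounded, a point mass placed where |f| is huge would be an
  admissible test sequence up to the factor coming from the positive weight
  \<open>\<Omega> 0\<close>.\<close>

lemma rearrangement_finite:
  assumes "N f < \<infinity>"
  shows "rearrangement f n < \<infinity>"
proof -
  have "rearrangement f 0 < \<infinity>"
  proof (rule ccontr)
    assume "\<not> ?thesis"
    then have inf: "rearrangement f 0 = \<infinity>" by (metis infinity_ennreal_def top.not_eq_extremum)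
    obtain \<nu> where \<nu>: "0 \<le> \<nu>" "N f = ennreal \<nu>" using assms by (cases "N f") auto
    \<comment> \<open>This level makes the normalised pairing equal to \<nu> + 1, beyond the
      associate norm.\<close>
    define R where "R = (\<nu> + 1) * \<Omega> 0 powr (1 / p)"
    have R: "0 < R" using \<nu> \<Omega>_0_pos by (simp add: R_def)
    define h :: "nat \<Rightarrow> real" where "h n = (if n = 0 then 1 else 0)" for n
    define r :: "nat \<Rightarrow> real" where "r n = R" for n
    have "ennreal ((\<Sum>n<1. r n * h n) / \<Omega> 0 powr (1 / p)) \<le> N f"
      by (rule associate_norm_ge_scaled)
        (use inf R \<Omega>_0_pos in \<open>auto simp: h_def r_def antimono_def\<close>)
    moreover have "(\<Sum>n<1. r n * h n) / \<Omega> 0 powr (1 / p) = \<nu> + 1"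
      using \<Omega>_0_pos by (simp add: r_def h_def R_def)
    ultimately show False using \<nu> by simp
  qed
  then show ?thesis
    using antimonoD[OF rearrangement_antimono, of 0 n f] by (auto intro: le_less_trans)
qed

text \<open>After Abel summation on both sides the terms are compared one by one. Those with
  \<open>y k = y (Suc k)\<close> vanish, and in the others the partial sum of \<open>r\<close> is
  W(k) y(k). \<open>y (Suc n) = 0\<close> removes the boundary terms.\<close>

lemma sum_weight_le:
  fixes y r :: "nat \<Rightarrow> real"
  assumes anti: "\<And>k. y (Suc k) \<le> y k" and nn: "\<And>k. 0 \<le> y k" and zero: "y (Suc n) = 0"
    and jump: "\<And>k. k \<le> n \<Longrightarrow> y k = y (Suc k) \<or> (\<Sum>j\<le>k. r j) = W k * y k"
  shows "(\<Sum>k\<le>n. \<Omega> k * y k powr q) \<le> p * (\<Sum>k\<le>n. r k * y k powr (q - 1))"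
proof -
  have term_le: "W k * (y k powr q - y (Suc k) powr q)
      \<le> p * ((\<Sum>j\<le>k. r j) * (y k powr (q - 1) - y (Suc k) powr (q - 1)))" if "k \<le> n" for k
  proof (cases "y k = y (Suc k)")
    case False
    with jump[OF that] have F: "(\<Sum>j\<le>k. r j) = W k * y k" by simp
    have *: "y k powr q = y k * y k powr (q - 1)"
      using powr_mult_base[of "y k" "q - 1"] nn by simp
    \<comment> \<open>With z = y(k+1) and p/q = p - 1, Young gives p y z^(q-1) <= (p-1) y^q + z^q,
      that is, y^q - z^q <= p y (y^(q-1) - z^(q-1)).\<close>
    have "p * (y k * y (Suc k) powr (q - 1)) \<le> p * (y k powr q / q + y (Suc k) powr q / p)"
      using p nn by (intro mult_left_mono Young) auto
    also have "\<dots> = (p / q) * y k powr q + y (Suc k) powr q" using p by (simp add: field_simps)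
    also have "p / q = p - 1" using conj_mult(2) by simp
    finally have "y k powr q - y (Suc k) powr q \<le> p * (y k * (y k powr (q - 1) - y (Suc k) powr (q - 1)))"
      by (simp add: algebra_simps *)
    then have "W k * (y k powr q - y (Suc k) powr q)
        \<le> W k * (p * (y k * (y k powr (q - 1) - y (Suc k) powr (q - 1))))"
      using W_pos[of k] by (intro mult_left_mono) auto
    then show ?thesis by (simp add: F ac_simps)
  qed simp
  have "(\<Sum>k\<le>n. \<Omega> k * y k powr q) = (\<Sum>k\<le>n. W k * (y k powr q - y (Suc k) powr q))"
    using sum_mult_by_parts[of \<Omega> "\<lambda>k. y k powr q" n] by (simp add: zero W_def)
  also have "\<dots> \<le> (\<Sum>k\<le>n. p * ((\<Sum>j\<le>k. r j) * (y k powr (q - 1) - y (Suc k) powr (q - 1))))"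
    using term_le by (intro sum_mono) auto
  also have "\<dots> = p * (\<Sum>k\<le>n. r k * y k powr (q - 1))"
    using sum_mult_by_parts[of r "\<lambda>k. y k powr (q - 1)" n] by (simp add: zero sum_distrib_left)
  finally show ?thesis .
qed

lemma sum_le_associate_norm:
  fixes r :: "nat \<Rightarrow> real"
  assumes r: "\<And>k. k \<le> n \<Longrightarrow> r k = 0 \<or> (0 < r k \<and> ennreal (r k) < rearrangement f k)"
    and dec: "\<And>j k. j \<le> k \<Longrightarrow> k \<le> n \<Longrightarrow> r k \<le> r j"
    and \<nu>: "0 \<le> \<nu>" "N f = ennreal \<nu>"
  shows "(\<Sum>k\<le>n. r k powr q * c k powr (1 - q)) \<le> p powr (q / p) * \<nu> powr q"
proof -
  have r0: "0 \<le> r k" if "k \<le> n" for k using r[OF that] by auto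
  define F where "F k = (\<Sum>j\<le>k. r j)" for k
  have F0: "0 \<le> F k" if "k \<le> n" for k unfolding F_def using r0 that by (intro sum_nonneg) auto
  \<comment> \<open>The least nonincreasing majorant of F/W on \<open>{..n}\<close>, continued by 0
    so that Abel summation leaves no boundary term.\<close>
  define y where "y k = (if k \<le> n then Max ((\<lambda>j. F j / W j) ` {k..n}) else 0)" for k
  have y_ge: "F j / W j \<le> y k" if "k \<le> j" "j \<le> n" for j k
    using that by (auto simp: y_def intro!: Max_ge)
  have y0: "0 \<le> y k" for k
  proof (cases "k \<le> n")
    case True
    then show ?thesis using y_ge[of k k] F0[of k] W_pos[of k] by (auto intro: order_trans[rotated])
  qed (simp add: y_def)
  have anti: "y (Suc k) \<le> y k" for k
  proof (cases "Suc k \<le> n")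
    case True
    then have "Max ((\<lambda>j. F j / W j) ` {Suc k..n}) \<le> Max ((\<lambda>j. F j / W j) ` {k..n})"
      by (intro Max_mono) auto
    with True show ?thesis by (simp add: y_def)
  next
    case False
    then have "y (Suc k) = 0" by (simp add: y_def)
    then show ?thesis using y0 by simp
  qed
  then have y_anti: "antimono y" by (rule decseq_SucI)
  \<comment> \<open>If the maximum defining \<open>y k\<close> is attained at \<open>k\<close>, the
    second alternative holds; if it is attained later, \<open>y\<close> does not drop after
    \<open>k\<close>.\<close>
  have jump: "y k = y (Suc k) \<or> F k = W k * y k" if k: "k \<le> n" for k
  proof -
    have "y k \<in> (\<lambda>j. F j / W j) ` {k..n}"
      using k unfolding y_def by (simp only: if_True) (intro Max_in, auto)
    then obtain j where j: "k \<le> j" "j \<le> n" "y k = F j / W j" by auto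
    show ?thesis
    proof (cases "j = k")
      case True
      then show ?thesis using j W_pos[of k] by simp
    next
      case False
      then have "y k \<le> y (Suc k)" using j y_ge[of "Suc k" j] by simp
      then show ?thesis using anti[of k] by simp
    qed
  qed
  define K where "K = (\<Sum>k\<le>n. r k * y k powr (q - 1))"
  have weight: "(\<Sum>k\<le>n. \<Omega> k * y k powr q) \<le> p * K"
    unfolding K_def using anti y0 jump by (intro sum_weight_le) (auto simp: y_def F_def)
  have K0: "0 \<le> K" unfolding K_def using r0 by (intro sum_nonneg) auto
  \<comment> \<open>The test sequence is normalised by (p K)^(1/p), which requires K > 0. Duality
    then gives K^(1/q) <= p^(1/p) \<nu>, and the q-th power is the claim.\<close>
  have "K \<le> p powr (q / p) * \<nu> powr q"
  proof (cases "K = 0")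
    case False
    with K0 have K: "0 < K" by simp
    \<comment> \<open>the decreasing test sequence at which the duality bound is almost attained\<close>
    define h where "h k = y k powr (q - 1)" for k
    have h0: "0 \<le> h k" for k by (simp add: h_def)
    have "antimono h"
      using y_anti y0 q by (auto simp: antimono_def h_def intro!: powr_mono2)
    moreover have "h k = 0" if "Suc n \<le> k" for k using that by (simp add: h_def y_def)
    moreover have "(\<Sum>k<Suc n. h k powr p * \<Omega> k) \<le> p * K"
    proof -
      have *: "h k powr p * \<Omega> k = \<Omega> k * y k powr q" for k
        by (simp add: h_def powr_powr conj_mult)
      show ?thesis using weight by (simp only: * lessThan_Suc_atMost)
    qed
    ultimately have "ennreal ((\<Sum>k<Suc n. r k * h k) / (p * K) powr (1 / p)) \<le> N f"
      using r K p h0 by (intro associate_norm_ge_scaled) auto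
    then have "K / (p * K) powr (1 / p) \<le> \<nu>"
      using \<nu> by (simp add: h_def K_def lessThan_Suc_atMost)
    moreover have "K / (p * K) powr (1 / p) = K powr (1 / q) / p powr (1 / p)"
    proof -
      have "K = K powr (1 / q) * K powr (1 / p)" using K pq by (simp add: add.commute flip: powr_add)
      then show ?thesis using K p by (simp add: powr_mult field_simps)
    qed
    ultimately have "K powr (1 / q) / p powr (1 / p) \<le> \<nu>" by simp
    then have "K powr (1 / q) \<le> p powr (1 / p) * \<nu>" using p by (simp add: pos_divide_le_eq mult.commute)
    then have "(K powr (1 / q)) powr q \<le> (p powr (1 / p) * \<nu>) powr q"
      using q by (intro powr_mono2) auto
    then show ?thesis using K p q \<nu> by (simp add: powr_powr powr_mult)
  qed simp
  \<comment> \<open>As \<open>r\<close> is nonincreasing, (k+1) r(k) <= F(k), hence r(k)/c(k) <=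
    F(k)/W(k) <= y(k).\<close>
  moreover have "r k powr q * c k powr (1 - q) \<le> r k * y k powr (q - 1)" if k: "k \<le> n" for k
  proof -
    have "(real k + 1) * r k = (\<Sum>j\<le>k. r k)" by (simp add: add.commute)
    also have "\<dots> \<le> F k" unfolding F_def using dec k by (intro sum_mono) auto
    finally have "(real k + 1) * r k / W k \<le> F k / W k"
      using W_pos[of k] by (intro divide_right_mono) auto
    then have "r k / c k \<le> F k / W k" by (simp add: c_eq mult.commute)
    also have "\<dots> \<le> y k" using y_ge k by simp
    finally have "(r k / c k) powr (q - 1) \<le> y k powr (q - 1)"
      using r0[OF k] c_pos[of k] q by (intro powr_mono2) auto
    then have "r k * (r k / c k) powr (q - 1) \<le> r k * y k powr (q - 1)"
      using r0[OF k] by (rule mult_left_mono)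
    moreover have "r k * (r k / c k) powr (q - 1) = r k powr q * c k powr (1 - q)"
    proof -
      have "c k powr (1 - q) = 1 / c k powr (q - 1)"
        using powr_minus[of "c k" "q - 1"] by (simp add: divide_inverse)
      then show ?thesis
        using r0[OF k] c_pos[of k] powr_mult_base[of "r k" "q - 1"] by (simp add: powr_divide)
    qed
    ultimately show ?thesis by simp
  qed
  then have "(\<Sum>k\<le>n. r k powr q * c k powr (1 - q)) \<le> K"
    unfolding K_def by (intro sum_mono) auto
  ultimately show ?thesis by linarith
qed

text \<open>The constant collects \<gamma> from the hypothesis on partial sums, 2^q from halving the
  rearrangement, and p^(q/p) from \<open>sum_le_associate_norm\<close>.\<close>

lemma lorentz_norm_le_associate_norm:
  assumes \<gamma>: "0 \<le> \<gamma>"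
    and V_le: "\<And>n. (\<Sum>k\<le>n. V k) \<le> ennreal \<gamma> * (\<Sum>k\<le>n. ennreal (c k powr (1 - q)))"
    and fin: "N f < \<infinity>"
  shows "M f \<le> ennreal ((\<gamma> * 2 powr q * p powr (q / p)) powr (1 / q)) * N f"
proof -
  let ?r = "\<lambda>k. enn2real (rearrangement f k) / 2"
  let ?D = "\<gamma> * 2 powr q * p powr (q / p)"
  obtain \<nu> where \<nu>: "0 \<le> \<nu>" "N f = ennreal \<nu>" using fin by (cases "N f") auto
  have f_fin: "rearrangement f k < top" for k using rearrangement_finite[OF fin] by simp
  have f_eq: "ennreal_powr (rearrangement f k) q = ennreal (2 powr q * ?r k powr q)" for k
  proof -
    obtain s where s: "rearrangement f k = ennreal s" "0 \<le> s"
      using f_fin[of k] by (auto simp: less_top_ennreal)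
    then have "ennreal_powr (rearrangement f k) q = ennreal (s powr q)"
      using q by (simp only:) (intro ennreal_powr_ennreal, auto)
    then show ?thesis using s by (simp add: powr_divide)
  qed
  have anti: "antimono (\<lambda>k. ennreal_powr (rearrangement f k) q)"
    using q rearrangement_antimono[of f] by (auto simp: antimono_def intro: ennreal_powr_mono)
  have "(\<Sum>k. ennreal_powr (rearrangement f k) q * V k) \<le> ennreal (?D * \<nu> powr q)"
  proof (rule suminf_le_ennreal)
    fix n
    \<comment> \<open>Halving a finite value makes it strictly smaller unless it is 0, which is what
      the choice of positions demands.\<close>
    have "?r k = 0 \<or> (0 < ?r k \<and> ennreal (?r k) < rearrangement f k)" for k
    proof -
      obtain s where "rearrangement f k = ennreal s" "0 \<le> s"
        using f_fin[of k] by (auto simp: less_top_ennreal)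
      then show ?thesis by (cases "s = 0") (auto simp: ennreal_less_iff)
    qed
    moreover have "?r k \<le> ?r j" if "j \<le> k" for j k
      using antimonoD[OF rearrangement_antimono that, of f] f_fin[of j] by (simp add: enn2real_mono)
    ultimately have "(\<Sum>k\<le>n. ?r k powr q * c k powr (1 - q)) \<le> p powr (q / p) * \<nu> powr q"
      using \<nu> by (intro sum_le_associate_norm) auto
    then have "(\<gamma> * 2 powr q) * (\<Sum>k\<le>n. ?r k powr q * c k powr (1 - q))
        \<le> (\<gamma> * 2 powr q) * (p powr (q / p) * \<nu> powr q)"
      using \<gamma> by (intro mult_left_mono) auto
    then have le: "(\<Sum>k\<le>n. (2 powr q * ?r k powr q) * (\<gamma> * c k powr (1 - q))) \<le> ?D * \<nu> powr q"
      by (simp add: sum_distrib_left ac_simps)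
    have "(\<Sum>k\<le>m. V k) \<le> (\<Sum>k\<le>m. ennreal (\<gamma> * c k powr (1 - q)))" for m
      using V_le[of m] \<gamma> by (simp only: ennreal_mult' sum_distrib_left)
    then have "(\<Sum>k\<le>n. ennreal_powr (rearrangement f k) q * V k)
        \<le> (\<Sum>k\<le>n. ennreal_powr (rearrangement f k) q * ennreal (\<gamma> * c k powr (1 - q)))"
      by (intro sum_mult_le_antimono anti)
    also have "\<dots> = (\<Sum>k\<le>n. ennreal ((2 powr q * ?r k powr q) * (\<gamma> * c k powr (1 - q))))"
      using \<gamma> unfolding f_eq by (intro sum.cong refl ennreal_mult[symmetric]) auto
    also have "\<dots> = ennreal (\<Sum>k\<le>n. (2 powr q * ?r k powr q) * (\<gamma> * c k powr (1 - q)))"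
      using \<gamma> by (intro sum_ennreal) auto
    also have "\<dots> \<le> ennreal (?D * \<nu> powr q)" using le by (rule ennreal_leI)
    finally show "(\<Sum>k\<le>n. ennreal_powr (rearrangement f k) q * V k) \<le> ennreal (?D * \<nu> powr q)" .
  qed
  then have "M f \<le> ennreal_powr (ennreal (?D * \<nu> powr q)) (1 / q)"
    unfolding lorentz_norm_def using q by (intro ennreal_powr_mono) auto
  also have "\<dots> = ennreal ((?D * \<nu> powr q) powr (1 / q))"
    using \<gamma> \<nu> p q by (intro ennreal_powr_ennreal) (auto simp: order_le_less)
  also have "(?D * \<nu> powr q) powr (1 / q) = ?D powr (1 / q) * \<nu>"
    using \<nu> q by (simp add: powr_mult powr_powr)
  finally show ?thesis using \<nu> by (simp add: ennreal_mult)
qed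

section \<open>The equivalence and the regular case\<close>

lemma same_space_if_sum_le:
  assumes C: "C < \<infinity>"
    and V_le: "\<And>n. (\<Sum>k\<le>n. V k) \<le> C * (\<Sum>k\<le>n. ennreal (c k powr (1 - q)))"
  shows "same_space N M"
proof -
  obtain \<gamma> where \<gamma>: "0 \<le> \<gamma>" "C = ennreal \<gamma>" using C by (cases C) auto
  \<comment> \<open>\<open>D\<close> may be 0, whereas \<open>same_space\<close> asks for positive
    constants; hence \<open>D + 1\<close> below.\<close>
  define D where "D = (\<gamma> * 2 powr q * p powr (q / p)) powr (1 / q)"
  have M_le: "M f \<le> ennreal (D + 1) * N f" if "N f < \<infinity>" for f
  proof -
    have "M f \<le> ennreal D * N f"
      unfolding D_def using lorentz_norm_le_associate_norm[of \<gamma> f] \<gamma> V_le that by simp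
    also have "\<dots> \<le> ennreal (D + 1) * N f" by (intro mult_right_mono ennreal_leI) auto
    finally show ?thesis .
  qed
  have "M f < \<infinity> \<longleftrightarrow> N f < \<infinity>" for f
  proof
    assume "N f < \<infinity>"
    then have "ennreal (D + 1) * N f < \<infinity>" by (simp add: ennreal_mult_less_top)
    with M_le[OF \<open>N f < \<infinity>\<close>] show "M f < \<infinity>" by (rule le_less_trans)
  qed (rule le_less_trans[OF associate_norm_le])
  then have "space_of N = space_of M" by (auto simp: space_of_def)
  moreover have "0 < D + 1" by (simp add: D_def add_nonneg_pos)
  moreover have "ennreal 1 * N f \<le> M f \<and> M f \<le> ennreal (D + 1) * N f" if "f \<in> space_of N" for f
    using that M_le[of f] associate_norm_le[of f] by (simp add: space_of_def)
  ultimately show ?thesis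
    unfolding same_space_def by (intro conjI exI[of _ 1] exI[of _ "D + 1"]) auto
qed

lemma sum_le_if_same_space:
  assumes "same_space N M"
  shows "\<exists>C<\<infinity>. \<forall>n. (\<Sum>k\<le>n. V k) \<le> C * (\<Sum>k\<le>n. ennreal (c k powr (1 - q)))"
proof -
  obtain B :: real where B: "0 < B" "\<And>f. N f < \<infinity> \<Longrightarrow> M f \<le> ennreal B * N f"
    using assms by (auto simp: same_space_def space_of_def)
  have "(\<Sum>k\<le>n. V k) \<le> ennreal (B powr q * q) * (\<Sum>k\<le>n. ennreal (c k powr (1 - q)))" for n
  proof -
    let ?\<chi> = "\<lambda>k::nat. if k \<le> n then 1 else 0 :: complex"
    let ?S = "\<Sum>k\<le>n. c k powr (1 - q)"
    have S: "0 \<le> ?S" by (intro sum_nonneg) auto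
    have N_le: "N ?\<chi> \<le> ennreal_powr (ennreal (q * ?S)) (1 / q)" by (rule associate_norm_indicator_le)
    \<comment> \<open>The constant \<open>B\<close> is available only on the space, so the
      characteristic function must first be seen to belong to it.\<close>
    also have "\<dots> < \<infinity>" using q by (simp add: ennreal_powr_less_top del: infinity_ennreal_def) simp
    finally have "ennreal_powr (\<Sum>k\<le>n. V k) (1 / q) \<le> ennreal B * N ?\<chi>"
      using lorentz_norm_indicator_ge[of n] B(2)[of ?\<chi>] by (meson order_trans)
    also have "\<dots> \<le> ennreal B * ennreal_powr (ennreal (q * ?S)) (1 / q)"
      using N_le by (intro mult_left_mono) auto
    finally have "ennreal_powr (ennreal_powr (\<Sum>k\<le>n. V k) (1 / q)) q
        \<le> ennreal_powr (ennreal B * ennreal_powr (ennreal (q * ?S)) (1 / q)) q"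
      using q by (intro ennreal_powr_mono) auto
    then have "(\<Sum>k\<le>n. V k) \<le> ennreal_powr (ennreal B) q * ennreal (q * ?S)"
      using q by (simp add: ennreal_powr_powr ennreal_powr_mult)
    also have "\<dots> = ennreal (B powr q * q) * ennreal ?S"
      using B(1) q S by (simp add: ennreal_powr_ennreal ennreal_mult mult.assoc)
    finally show ?thesis by simp
  qed
  then show ?thesis by (intro exI[of _ "ennreal (B powr q * q)"]) auto
qed

text \<open>Positivity of the means forces \<Omega> to be positive everywhere. The negative exponent
  1 - q then reverses c <= B \<Omega>, and the comparison holds term by term.\<close>

lemma sum_le_if_regular:
  assumes "regular_seq \<Omega>"
  shows "\<exists>C<\<infinity>. \<forall>n. (\<Sum>k\<le>n. V k) \<le> C * (\<Sum>k\<le>n. ennreal (c k powr (1 - q)))"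
proof -
  obtain B where B: "0 < B" "\<And>n. c n \<le> B * \<Omega> n" using assms by (auto simp: regular_seq_def)
  have "V k \<le> ennreal (B powr (q - 1)) * ennreal (c k powr (1 - q))" for k
  proof -
    have "0 < B * \<Omega> k" using c_pos[of k] B(2)[of k] by linarith
    then have \<Omega>: "0 < \<Omega> k" using B(1) by (simp add: zero_less_mult_iff)
    have "(B * \<Omega> k) powr (1 - q) \<le> c k powr (1 - q)"
      using B(2) c_pos q by (intro powr_mono2') auto
    then have "B powr (q - 1) * (B powr (1 - q) * \<Omega> k powr (1 - q)) \<le> B powr (q - 1) * c k powr (1 - q)"
      using B(1) \<Omega> by (intro mult_left_mono) (auto simp: powr_mult)
    moreover have "B powr (q - 1) * B powr (1 - q) = 1" using B(1) by (simp flip: powr_add)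
    ultimately have "\<Omega> k powr (1 - q) \<le> B powr (q - 1) * c k powr (1 - q)"
      by (simp flip: mult.assoc)
    then show ?thesis using \<Omega> by (simp add: ennreal_powr_ennreal ennreal_leI flip: ennreal_mult')
  qed
  then have "(\<Sum>k\<le>n. V k) \<le> ennreal (B powr (q - 1)) * (\<Sum>k\<le>n. ennreal (c k powr (1 - q)))" for n
    unfolding sum_distrib_left by (intro sum_mono)
  then show ?thesis by (intro exI[of _ "ennreal (B powr (q - 1))"]) auto
qed

end

theorem theorem2p4p16:
  fixes p p' :: real and \<Omega> :: "nat \<Rightarrow> real"
  assumes "1 < p"
    and "1 / p + 1 / p' = 1"
    and "\<And>n. 0 \<le> \<Omega> n"
    and "\<Omega> 0 \<noteq> 0"
    and "\<not> summable (\<lambda>n. \<bar>\<Omega> n\<bar>)"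
  shows "(same_space (associate_norm (lorentz_norm (\<lambda>n. ennreal (\<Omega> n)) p))
            (lorentz_norm (\<lambda>n. ennreal_powr (ennreal (\<Omega> n)) (1 - p')) p')
          \<longleftrightarrow>
          (\<exists>C::ennreal. C < \<infinity> \<and>
             (\<forall>n. (\<Sum>k\<le>n. ennreal_powr (ennreal (\<Omega> k)) (1 - p'))
                  \<le> C * (\<Sum>k\<le>n. ennreal_powr (ennreal (discrete_hardy \<Omega> k)) (1 - p')))))
       \<and> (regular_seq \<Omega> \<longrightarrow>
          same_space (associate_norm (lorentz_norm (\<lambda>n. ennreal (\<Omega> n)) p))
            (lorentz_norm (\<lambda>n. ennreal_powr (ennreal (\<Omega> n)) (1 - p')) p'))"
proof -
  interpret lorentz_weight p p' \<Omega>
    using assms by unfold_locales auto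
  show ?thesis
    \<comment> \<open>The means are positive, so the sums on the right-hand side of the condition
      involve ordinary real powers only.\<close>
    unfolding powr_c using same_space_if_sum_le sum_le_if_same_space sum_le_if_regular by blast
qed

end
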